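(* Let $d\ge 1$ be an integer, let $0\le p\le 1$, and let $K:\mathbb{R}_+\to[0,1]$ be a decreasing link probability function with $0<\int_0^\infty u^{d-1}K(u)\,du<\infty$. The $d$-dimensional rectangular sparse latent position network model with $g(t)=t^{p/d}$ and link probability function $K$ defines a projective sequence of models $(\mathbb{P}^n)_{n\ge 1}$.
   Context: $\mathbb{R}_+=[0,\infty)$; "decreasing" means non-increasing. Rectangular latent position model (rectangular LPM): let $g(t)=t^{p/d}$ and for $t>0$ let $$H(t)=[-g(t),g(t)]^d\times\left[0,\frac{t}{(2g(t))^d}\right]\subset\mathbb{R}^d\times\mathbb{R}_+ ,$$ a nested increasing family of observation windows with Lebesgue measure $|H(t)|=t$. Generate a unit-rate Poisson process $\Psi$ on $\mathbb{R}^d\times\mathbb{R}_+$. Each point $(Z,r)\in\Psi$ is a node with latent position $Z\in\mathbb{R}^d$ and auxiliary coordinate $r$. The arrival time of a node $(Z,r)$ is the smallest $t$ with $(Z,r)\in H(t)$. Nodes are numbered $1,2,\dots$ in order of arrival times $t_1<t_2<\cdots$ (almost surely strict). Conditional on $\Psi$, each pair of nodes $i\neq j$ is joined by an edge independently with probability $K(\|Z_i-Z_j\|)$ (Euclidean norm). $Y^n\in\{0,1\}^{n\times n}$ is the (symmetric, zero-diagonal) adjacency matrix of the subgraph induced by the first $n$ nodes to arrive (equivalently, the nodes visible in a window $H(t)$ containing exactly $n$ points of $\Psi$), and $\mathbb{P}^n$ is its distribution. Projectivity: a sequence $(\mathbb{P}^n)_{n\ge1}$ of distributions of random adjacency matrices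 $Y^n\in\{0,1\}^{n\times n}$ is projective if for all $n_1<n_2$ and all $y\in\{0,1\}^{n_1\times n_1}$, $$\mathbb{P}^{n_1}(Y^{n_1}=y)=\mathbb{P}^{n_2}(Y^{n_2}\in X),\qquad X=\{x\in\{0,1\}^{n_2\times n_2}: x_{ij}=y_{ij}\text{ for }1\le i,j\le n_1\}.$$ *)

theory Defs
  imports "HOL-Probability.Probability"
begin

definition point_count :: "('w \<Rightarrow> 'a set) \<Rightarrow> 'a set \<Rightarrow> 'w \<Rightarrow> ennreal" where
  "point_count \<Psi> B \<omega> = emeasure (count_space UNIV) (\<Psi> \<omega> \<inter> B)"

text \<open>A Poisson process with intensity measure \<open>\<mu>\<close>, realised as a random locally finite set of
  points. The Poisson probabilities are written out because the library's \<open>poisson_pmf\<close> is only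
  specified for positive rates, whereas \<open>measure \<mu> A\<close> may be zero. A Poisson variable with infinite
  mean is infinite almost surely.\<close>

locale poisson_process = prob_space M
  for M :: "'w measure" and \<mu> :: "'a::metric_space measure" and \<Psi> :: "'w \<Rightarrow> 'a set" +
  assumes points_in_space: "\<And>\<omega>. \<omega> \<in> space M \<Longrightarrow> \<Psi> \<omega> \<subseteq> space \<mu>"
    and locally_finite: "\<And>\<omega> A. \<omega> \<in> space M \<Longrightarrow> bounded A \<Longrightarrow> finite (\<Psi> \<omega> \<inter> A)"
    and measurable_count: "\<And>A. A \<in> sets \<mu> \<Longrightarrow> point_count \<Psi> A \<in> borel_measurable M"
    and poisson_count: "\<And>A k. A \<in> sets \<mu> \<Longrightarrow> emeasure \<mu> A < \<infinity> \<Longrightarrow>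
      prob {\<omega> \<in> space M. point_count \<Psi> A \<omega> = of_nat k} =
        measure \<mu> A ^ k / fact k * exp (- measure \<mu> A)"
    and infinite_count: "\<And>A. A \<in> sets \<mu> \<Longrightarrow> emeasure \<mu> A = \<infinity> \<Longrightarrow>
      AE \<omega> in M. point_count \<Psi> A \<omega> = \<infinity>"
    and indep_counts: "\<And>(m::nat) B. (\<And>i. i < m \<Longrightarrow> B i \<in> sets \<mu>) \<Longrightarrow>
      disjoint_family_on B {..<m} \<Longrightarrow> indep_vars (\<lambda>_. borel) (\<lambda>i. point_count \<Psi> (B i)) {..<m}"

definition window :: "(real \<Rightarrow> real) \<Rightarrow> real \<Rightarrow> ((real ^ 'd) \<times> real) set" where
  "window g t =
     {Z. \<forall>i. Z $ i \<in> {- g t .. g t}} \<times> {0 .. t / (2 * g t) ^ CARD('d)}"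

definition arriving :: "(real \<Rightarrow> real) \<Rightarrow> ((real ^ 'd) \<times> real) set \<Rightarrow> ((real ^ 'd) \<times> real) set" where
  "arriving g S = {z \<in> S. \<exists>t>0. z \<in> window g t}"

text \<open>For \<open>g t = t powr (p / d)\<close> the infimum is attained, i.e. it is the smallest \<open>t\<close>, except for
  the points of a Lebesgue null set that lie in every window.\<close>

definition arrival_time :: "(real \<Rightarrow> real) \<Rightarrow> (real ^ 'd) \<times> real \<Rightarrow> real" where
  "arrival_time g z = Inf {t. 0 < t \<and> z \<in> window g t}"

text \<open>The \<open>k\<close>-th node to arrive, \<open>k = 1, 2, \<dots>\<close>. The value \<open>0\<close> is only a default for
  configurations with tied arrival times or with fewer than \<open>k\<close> arriving points, which for the
  Poisson process is an event of probability zero.\<close>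

definition is_nth_node :: "(real \<Rightarrow> real) \<Rightarrow> ((real ^ 'd) \<times> real) set \<Rightarrow> nat \<Rightarrow> (real ^ 'd) \<times> real \<Rightarrow> bool"
  where "is_nth_node g S k z \<longleftrightarrow> z \<in> arriving g S \<and>
     card {z' \<in> arriving g S. arrival_time g z' \<le> arrival_time g z} = k"

definition nth_node :: "(real \<Rightarrow> real) \<Rightarrow> ((real ^ 'd) \<times> real) set \<Rightarrow> nat \<Rightarrow> (real ^ 'd) \<times> real" where
  "nth_node g S k =
     (if \<exists>!z. is_nth_node g S k z then THE z. is_nth_node g S k z else 0)"

definition latent_position :: "(real \<Rightarrow> real) \<Rightarrow> ((real ^ 'd) \<times> real) set \<Rightarrow> nat \<Rightarrow> real ^ 'd" where
  "latent_position g S k = fst (nth_node g S k)"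

definition node_pairs :: "(nat \<times> nat) set" where
  "node_pairs = {(i, j). 1 \<le> i \<and> i < j}"

text \<open>Conditional law of the edge indicators given the point configuration \<open>S\<close>. Nodes are
  identified with their arrival numbers and unordered pairs with pairs \<open>(i, j)\<close>, \<open>i < j\<close>.\<close>

definition edge_law ::
  "(real \<Rightarrow> real) \<Rightarrow> (real \<Rightarrow> real) \<Rightarrow> ((real ^ 'd) \<times> real) set \<Rightarrow> (nat \<times> nat \<Rightarrow> bool) measure" where
  "edge_law g K S = (\<Pi>\<^sub>M (i, j) \<in> node_pairs.
     measure_pmf (bernoulli_pmf (K (norm (latent_position g S i - latent_position g S j)))))"

text \<open>Law of the whole random graph: the mixture of the conditional laws over the point process.\<close>

definition graph_law :: "(real \<Rightarrow> real) \<Rightarrow> (real \<Rightarrow> real) \<Rightarrow> 'w measure \<Rightarrow>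
    ('w \<Rightarrow> ((real ^ 'd) \<times> real) set) \<Rightarrow> (nat \<times> nat \<Rightarrow> bool) measure" where
  "graph_law g K M \<Psi> = M \<bind> (\<lambda>\<omega>. edge_law g K (\<Psi> \<omega>))"

definition binary_matrices :: "nat \<Rightarrow> (nat \<times> nat \<Rightarrow> nat) set" where
  "binary_matrices n = {1..n} \<times> {1..n} \<rightarrow>\<^sub>E {0, 1}"

definition adjacency_matrix :: "nat \<Rightarrow> (nat \<times> nat \<Rightarrow> bool) \<Rightarrow> nat \<times> nat \<Rightarrow> nat" where
  "adjacency_matrix n e = (\<lambda>(i, j) \<in> {1..n} \<times> {1..n}.
     of_bool (i < j \<and> e (i, j) \<or> j < i \<and> e (j, i)))"

definition rectangular_LPM :: "real \<Rightarrow> (real \<Rightarrow> real) \<Rightarrow> 'w measure \<Rightarrow>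
    ('w \<Rightarrow> ((real ^ 'd) \<times> real) set) \<Rightarrow> nat \<Rightarrow> (nat \<times> nat \<Rightarrow> nat) measure" where
  "rectangular_LPM p K M \<Psi> n =
     distr (graph_law (\<lambda>t. t powr (p / CARD('d))) K M \<Psi>)
       (count_space (binary_matrices n)) (adjacency_matrix n)"

definition projective :: "(nat \<Rightarrow> (nat \<times> nat \<Rightarrow> nat) measure) \<Rightarrow> bool" where
  "projective P \<longleftrightarrow>
     (\<forall>n\<ge>1. prob_space (P n) \<and> sets (P n) = Pow (binary_matrices n)) \<and>
     (\<forall>n1 n2. 1 \<le> n1 \<longrightarrow> n1 < n2 \<longrightarrow>
       (\<forall>y \<in> binary_matrices n1.
          measure (P n1) {y} =
          measure (P n2) {x \<in> binary_matrices n2. \<forall>i\<in>{1..n1}. \<forall>j\<in>{1..n1}. x (i, j) = y (i, j)}))"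

end

theory Submission
  imports Defs
begin

text \<open>
  The nodes are numbered once and for all by their arrival times, so every finite graph of the model
  is a corner of one and the same infinite random graph: \<open>Y\<^sup>n\<close> is the adjacency matrix of the nodes
  \<open>1, \<dots>, n\<close> of a graph drawn from \<open>graph_law\<close>. Marginalising \<open>Y\<close> from \<open>n2\<close> to \<open>n1\<close> nodes therefore
  only discards entries, and the events compared in the definition of projectivity are the same event
  of the infinite graph (\<open>projective_adjacency_matrix_laws\<close>).

  What has to be proved is that the infinite graph exists as a random object: the mixture
  \<open>graph_law\<close> of the conditional edge laws must be a probability measure, which requires the
  conditional law \<open>edge_law g K (\<Psi> \<omega>)\<close> to depend measurably on \<open>\<omega>\<close>. A product of Bernoulli laws
  depends measurably on its parameters (\<open>measurable_PiM_kernel\<close>, \<open>measurable_bernoulli_kernel\<close>), and the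
  parameters are a monotone function of distances between latent positions, so the measurability
  of the \<open>k\<close>-th node to arrive is left.

  The point process reveals itself only through the numbers of its points in Borel sets. The
  windows increase with time because \<open>p \<in> [0, 1]\<close>: the width grows like \<open>t\<^sup>p\<^sup>/\<^sup>d\<close> and the height like
  \<open>t\<^sup>1\<^sup>-\<^sup>p\<close>. Hence the points that have arrived by time \<open>q\<close> are those in a bounded closed region
  \<open>arrived_by g q\<close>, which contains finitely many of them. Finiteness isolates distinct
  arrival times from each other, and the event that the \<open>k+1\<close>-st node is well defined and lies in \<open>B\<close>
  becomes a countable union over rational times \<open>q < q'\<close> of events about counts: \<open>k\<close> points have arrived by time \<open>q\<close>,
  one more by time \<open>q'\<close>, and the newcomer is in \<open>B\<close> (\<open>nth_node_in_iff_rational_counts\<close>).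
\<close>

section \<open>The window family\<close>

lemma window_eq_box:
  "(window g t :: ((real ^ 'd) \<times> real) set) =
    cbox (\<chi> i. - g t) (\<chi> i. g t) \<times> {0 .. t / (2 * g t) ^ CARD('d)}"
  unfolding window_def by (simp add: set_eq_iff mem_box_cart)

lemma closed_window: "closed (window g t :: ((real ^ 'd) \<times> real) set)"
  unfolding window_eq_box by (intro closed_Times closed_cbox closed_atLeastAtMost)

lemma bounded_window: "bounded (window g t :: ((real ^ 'd) \<times> real) set)"
  unfolding window_eq_box by (intro bounded_Times bounded_cbox bounded_closed_interval)

lemma window_subset_upper_half_space: "window g t \<subseteq> UNIV \<times> {0..}"
  unfolding window_def by auto

text \<open>The condition \<open>p \<ge> 0\<close> makes the width of the windows increase and \<open>p \<le> 1\<close> their height: the factor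
  \<open>(2 * g t) ^ d\<close> in the denominator is proportional to \<open>t powr p\<close>.\<close>

lemma window_powr_mono:
  assumes p: "0 \<le> p" "p \<le> 1"
  shows "mono_on {0<..} (window (\<lambda>t. t powr (p / CARD('d))) :: real \<Rightarrow> ((real ^ 'd) \<times> real) set)"
proof (rule mono_onI)
  fix s t :: real assume "s \<in> {0<..}" "s \<le> t"
  then have st: "0 < s" "s \<le> t" by auto
  define d where "d = CARD('d)"
  have d: "0 < d" unfolding d_def by simp
  have width: "s powr (p / d) \<le> t powr (p / d)"
    using p st d by (intro powr_mono2) auto
  have height: "u / (2 * u powr (p / d)) ^ d = u powr (1 - p) / 2 ^ d" if "0 < u" for u :: real
  proof -
    have "(u powr (p / d)) ^ d = u powr p"
      using that d by (simp add: powr_power)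
    then show ?thesis
      using that by (simp add: power_mult_distrib powr_diff)
  qed
  have "s powr (1 - p) / 2 ^ d \<le> t powr (1 - p) / 2 ^ d"
    using p st by (intro divide_right_mono powr_mono2) auto
  then have "s / (2 * s powr (p / d)) ^ d \<le> t / (2 * t powr (p / d)) ^ d"
    using height[of s] height[of t] st by simp
  then show "window (\<lambda>t. t powr (p / CARD('d))) s \<subseteq>
      (window (\<lambda>t. t powr (p / CARD('d))) t :: ((real ^ 'd) \<times> real) set)"
    using width unfolding window_eq_box d_def
    by (intro Sigma_mono) (auto simp: subset_interval_cart)
qed

definition arrived_by :: "(real \<Rightarrow> real) \<Rightarrow> real \<Rightarrow> ((real ^ 'd) \<times> real) set" where
  "arrived_by g q = arriving g {z. arrival_time g z \<le> q}"

text \<open>The arrival time is an infimum, so a point with arrival time \<open>q\<close> is known to lie in all later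
  windows, and by monotonicity a sequence of them decreasing to \<open>q\<close> suffices. The points
  that lie in every window arrive at time \<open>0\<close>, the case in which the infimum is not attained and for
  which the sequence has to stay strictly above \<open>q\<close>.\<close>

lemma arrived_by_eq_INT_window:
  fixes g :: "real \<Rightarrow> real"
  assumes mono: "mono_on {0<..} (window g :: real \<Rightarrow> ((real ^ 'd) \<times> real) set)"
  shows "(arrived_by g q :: ((real ^ 'd) \<times> real) set) =
    (if q < 0 then {} else (\<Inter>n. window g (q + 1 / Suc n)))"
proof -
  let ?T = "\<lambda>z::(real ^ 'd) \<times> real. {t. 0 < t \<and> z \<in> window g t}"
  have bdd: "bdd_below (?T z)" for z
    by (rule bdd_belowI[of _ 0]) auto
  have nonneg: "0 \<le> arrival_time g z" if "?T z \<noteq> {}" for z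
    unfolding arrival_time_def using that by (intro cInf_greatest) auto
  have "z \<in> arrived_by g q \<longleftrightarrow> (\<forall>n. z \<in> window g (q + 1 / Suc n))"
    if "0 \<le> q" for z :: "(real ^ 'd) \<times> real"
  proof
    assume z: "z \<in> arrived_by g q"
    then have ne: "?T z \<noteq> {}" and le: "Inf (?T z) \<le> q"
      unfolding arrived_by_def arriving_def arrival_time_def by auto
    show "\<forall>n. z \<in> window g (q + 1 / Suc n)"
    proof
      fix n
      have "Inf (?T z) < q + 1 / Suc n" using le by (simp add: le_less_trans)
      then obtain t where "t \<in> ?T z" "t < q + 1 / Suc n"
        using cInf_lessD[OF ne] by blast
      then show "z \<in> window g (q + 1 / Suc n)"
        using mono_onD[OF mono, of t "q + 1 / Suc n"] by auto
    qed
  next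
    assume all: "\<forall>n. z \<in> window g (q + 1 / Suc n)"
    have mem: "q + 1 / Suc n \<in> ?T z" for n
      using all that by (auto intro: add_nonneg_pos)
    have "Inf (?T z) \<le> q"
    proof (rule field_le_epsilon)
      fix e :: real assume "0 < e"
      then obtain n where n: "1 / Suc n < e" using nat_approx_posE by blast
      have "Inf (?T z) \<le> q + 1 / Suc n" by (rule cInf_lower[OF mem bdd])
      then show "Inf (?T z) \<le> q + e" using n by simp
    qed
    then show "z \<in> arrived_by g q"
      using mem[of 0] unfolding arrived_by_def arriving_def arrival_time_def by blast
  qed
  moreover have "arrived_by g q = ({} :: ((real ^ 'd) \<times> real) set)" if "q < 0"
    using nonneg that unfolding arrived_by_def arriving_def by fastforce
  ultimately show ?thesis by auto
qed

lemma
  fixes g :: "real \<Rightarrow> real"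
  assumes mono: "mono_on {0<..} (window g :: real \<Rightarrow> ((real ^ 'd) \<times> real) set)"
  shows borel_arrived_by: "(arrived_by g q :: ((real ^ 'd) \<times> real) set) \<in> sets borel"
    and bounded_arrived_by: "bounded (arrived_by g q :: ((real ^ 'd) \<times> real) set)"
    and arrived_by_subset_upper_half_space:
      "(arrived_by g q :: ((real ^ 'd) \<times> real) set) \<subseteq> UNIV \<times> {0..}"
proof -
  note eq = arrived_by_eq_INT_window[OF mono, of q]
  have "closed (arrived_by g q :: ((real ^ 'd) \<times> real) set)"
    unfolding eq by (auto intro: closed_INT closed_window)
  then show "(arrived_by g q :: ((real ^ 'd) \<times> real) set) \<in> sets borel"
    by (rule borel_closed)
  have sub: "\<exists>t. (arrived_by g q :: ((real ^ 'd) \<times> real) set) \<subseteq> window g t"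
    unfolding eq by auto
  show "bounded (arrived_by g q :: ((real ^ 'd) \<times> real) set)"
    using sub bounded_window bounded_subset by metis
  show "(arrived_by g q :: ((real ^ 'd) \<times> real) set) \<subseteq> UNIV \<times> {0..}"
    using sub window_subset_upper_half_space by fast
qed

section \<open>The nodes in order of arrival\<close>

text \<open>Let \<open>\<tau>\<close> have finite sublevel sets \<open>L q\<close>, and let the rank of a point be the size of its own
  sublevel set. If \<open>z\<close> is the only point of rank \<open>k + 1\<close>, no other point shares its \<open>\<tau>\<close>-value, and rational
  numbers \<open>q < \<tau> z \<le> q'\<close> chosen closer than the neighbouring values separate \<open>z\<close> from all other points;
  conversely, a jump of the count from \<open>k\<close> to \<open>k + 1\<close> between \<open>q\<close> and \<open>q'\<close> is caused by exactly one point.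
  This trades a statement about an uncountable family of levels for countably many counts.\<close>

lemma unique_of_rank_iff_rational_counts:
  fixes \<tau> :: "'a \<Rightarrow> real" and A B :: "'a set" and L :: "real \<Rightarrow> 'a set"
  assumes L_def: "\<And>q. L q = {z \<in> A. \<tau> z \<le> q}"
    and fin: "\<And>q. finite (L q)"
  shows "(\<exists>z\<in>B. \<forall>z'. z' \<in> A \<and> card (L (\<tau> z')) = Suc k \<longleftrightarrow> z' = z) \<longleftrightarrow>
    (\<exists>q\<in>\<rat>. \<exists>q'\<in>\<rat>. q < q' \<and> card (L q) = k \<and> card (L q') = Suc k \<and>
       card ((L q' - L q) \<inter> B) = 1)"
proof
  assume "\<exists>z\<in>B. \<forall>z'. z' \<in> A \<and> card (L (\<tau> z')) = Suc k \<longleftrightarrow> z' = z"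
  then obtain z where z: "z \<in> B" "z \<in> A" "card (L (\<tau> z)) = Suc k"
    and uniq: "\<And>z'. z' \<in> A \<Longrightarrow> card (L (\<tau> z')) = Suc k \<Longrightarrow> z' = z" by blast
  define s where "s = \<tau> z"
  \<comment> \<open>Values up to \<open>s + 1\<close> are taken by finitely many points, and \<open>s + 1\<close> and \<open>s - 1\<close> are inserted
    so that a nearest competitor of \<open>s\<close> exists on each side.\<close>
  define later where "later = insert (s + 1) {x \<in> \<tau> ` L (s + 1). s < x}"
  define earlier where "earlier = insert (s - 1) {x \<in> \<tau> ` L (s + 1). x < s}"
  have later: "finite later" "later \<noteq> {}" and earlier: "finite earlier" "earlier \<noteq> {}"
    using fin by (auto simp: later_def earlier_def)
  have "s < Min later" unfolding Min_gr_iff[OF later] by (auto simp: later_def)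
  then obtain q' where q': "q' \<in> \<rat>" "s < q'" "q' < Min later"
    using Rats_dense_in_real by blast
  have "Max earlier < s" unfolding Max_less_iff[OF earlier] by (auto simp: earlier_def)
  then obtain q where q: "q \<in> \<rat>" "Max earlier < q" "q < s"
    using Rats_dense_in_real by blast
  have "L q' = L s"
  proof
    show "L q' \<subseteq> L s"
    proof
      fix x assume x: "x \<in> L q'"
      have "q' < s + 1" using q'(3) unfolding Min_gr_iff[OF later] by (simp add: later_def)
      then have "\<tau> x \<in> \<tau> ` L (s + 1)" using x by (auto simp: L_def)
      moreover have "\<tau> x \<notin> later"
        using x q' Min_le[OF later(1), of "\<tau> x"] by (auto simp: L_def)
      ultimately show "x \<in> L s" using x by (auto simp: L_def later_def)
    qed
  qed (use q' in \<open>auto simp: L_def\<close>)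
  \<comment> \<open>Any other point at level \<open>s\<close> would have the same rank as \<open>z\<close>.\<close>
  moreover have "L q = L s - {z}"
  proof
    show "L s - {z} \<subseteq> L q"
    proof
      fix x assume x: "x \<in> L s - {z}"
      have "\<tau> x \<noteq> s" using x uniq[of x] z(3) by (auto simp: L_def s_def)
      then have "\<tau> x \<in> earlier" using x by (auto simp: L_def earlier_def)
      then have "\<tau> x < q" using Max_ge[OF earlier(1), of "\<tau> x"] q by simp
      then show "x \<in> L q" using x by (auto simp: L_def)
    qed
  qed (use q in \<open>auto simp: L_def s_def\<close>)
  moreover have "z \<in> L s" using z by (auto simp: L_def s_def)
  ultimately have "card (L q) = k" "card (L q') = Suc k" "(L q' - L q) \<inter> B = {z}"
    using z fin by (auto simp: s_def)
  then show "\<exists>q\<in>\<rat>. \<exists>q'\<in>\<rat>. q < q' \<and> card (L q) = k \<and> card (L q') = Suc k \<and>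
       card ((L q' - L q) \<inter> B) = 1"
    using q q' by (intro bexI[of _ q] bexI[of _ q']) auto
next
  assume "\<exists>q\<in>\<rat>. \<exists>q'\<in>\<rat>. q < q' \<and> card (L q) = k \<and> card (L q') = Suc k \<and>
       card ((L q' - L q) \<inter> B) = 1"
  then obtain q q' where q: "q < q'" "card (L q) = k" "card (L q') = Suc k"
    and one: "card ((L q' - L q) \<inter> B) = 1" by blast
  have sub: "L q \<subseteq> L q'" using q by (auto simp: L_def)
  then have "card (L q' - L q) = 1" using q fin by (simp add: card_Diff_subset)
  then obtain z where z: "L q' - L q = {z}" by (auto simp: card_1_singleton_iff)
  have "z \<in> B" using one z by (cases "z \<in> B") auto
  have bounds: "z \<in> A" "q < \<tau> z" "\<tau> z \<le> q'" using z by (auto simp: L_def)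
  have "L (\<tau> z) = L q'"
  proof
    show "L q' \<subseteq> L (\<tau> z)"
    proof
      fix x assume "x \<in> L q'"
      then have "x = z \<or> x \<in> L q" using z by blast
      then show "x \<in> L (\<tau> z)" using bounds by (auto simp: L_def)
    qed
  qed (use bounds in \<open>auto simp: L_def\<close>)
  then have rank: "card (L (\<tau> z)) = Suc k" using q by simp
  have uniq: "z' = z" if z': "z' \<in> A" "card (L (\<tau> z')) = Suc k" for z'
  proof (rule ccontr)
    assume "z' \<noteq> z"
    then consider "z' \<in> L q" | "z' \<notin> L q'" using z by blast
    then show False
    proof cases
      case 1
      then have "L (\<tau> z') \<subseteq> L q" by (auto simp: L_def)
      then show False using card_mono[OF fin[of q], of "L (\<tau> z')"] q z' by simp
    next
      case 2
      then have "insert z' (L q') \<subseteq> L (\<tau> z')" using z' by (auto simp: L_def)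
      then have "card (insert z' (L q')) \<le> card (L (\<tau> z'))" using fin by (intro card_mono)
      then show False using 2 q z' fin by simp
    qed
  qed
  show "\<exists>z\<in>B. \<forall>z'. z' \<in> A \<and> card (L (\<tau> z')) = Suc k \<longleftrightarrow> z' = z"
  proof (intro bexI[of _ z] allI iffI)
    fix z' assume "z' \<in> A \<and> card (L (\<tau> z')) = Suc k"
    then show "z' = z" by (intro uniq) auto
  qed (use \<open>z \<in> B\<close> bounds rank in auto)
qed

lemma nth_node_in_iff_rational_counts:
  fixes g :: "real \<Rightarrow> real" and S B :: "((real ^ 'd) \<times> real) set"
  assumes mono: "mono_on {0<..} (window g :: real \<Rightarrow> ((real ^ 'd) \<times> real) set)"
    and locally_finite: "\<And>A. bounded A \<Longrightarrow> finite (S \<inter> A)"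
  shows "(\<exists>!z. is_nth_node g S (Suc k) z) \<and> nth_node g S (Suc k) \<in> B \<longleftrightarrow>
    (\<exists>q\<in>\<rat>. \<exists>q'\<in>\<rat>. q < q' \<and> card (S \<inter> arrived_by g q) = k \<and>
       card (S \<inter> arrived_by g q') = Suc k \<and>
       card (S \<inter> ((arrived_by g q' - arrived_by g q) \<inter> B)) = 1)"
proof -
  have sublevel: "{z \<in> arriving g S. arrival_time g z \<le> q} = S \<inter> arrived_by g q" for q
    unfolding arrived_by_def arriving_def by auto
  have diff: "(S \<inter> X - S \<inter> Y) \<inter> B = S \<inter> ((X - Y) \<inter> B)" for X Y by auto
  have fin: "finite (S \<inter> arrived_by g q)" for q
    by (rule locally_finite[OF bounded_arrived_by[OF mono]])
  have "(\<exists>!z. is_nth_node g S (Suc k) z) \<and> nth_node g S (Suc k) \<in> B \<longleftrightarrow>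
    (\<exists>z\<in>B. \<forall>z'. is_nth_node g S (Suc k) z' \<longleftrightarrow> z' = z)"
  proof
    assume asm: "(\<exists>!z. is_nth_node g S (Suc k) z) \<and> nth_node g S (Suc k) \<in> B"
    then obtain z where z: "\<forall>z'. is_nth_node g S (Suc k) z' \<longleftrightarrow> z' = z" by blast
    then have "is_nth_node g S (Suc k) = (\<lambda>z'. z' = z)" by blast
    then have "nth_node g S (Suc k) = z" by (simp add: nth_node_def)
    with z asm show "\<exists>z\<in>B. \<forall>z'. is_nth_node g S (Suc k) z' \<longleftrightarrow> z' = z" by blast
  next
    assume "\<exists>z\<in>B. \<forall>z'. is_nth_node g S (Suc k) z' \<longleftrightarrow> z' = z"
    then obtain z where "z \<in> B" and z: "is_nth_node g S (Suc k) = (\<lambda>z'. z' = z)" by blast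
    then show "(\<exists>!z. is_nth_node g S (Suc k) z) \<and> nth_node g S (Suc k) \<in> B"
      by (simp add: nth_node_def)
  qed
  then show ?thesis
    using unique_of_rank_iff_rational_counts[OF sublevel[symmetric] fin, of B k]
    unfolding is_nth_node_def sublevel diff by simp
qed

section \<open>Measurability of the latent positions\<close>

text \<open>Counts are \<open>ennreal\<close>-valued in the definition of a Poisson process; on bounded sets they are finite
  and agree with the cardinality used to rank the nodes, which would be \<open>0\<close> on an infinite set.\<close>

lemma poisson_card_measurable:
  fixes \<Psi> :: "'w \<Rightarrow> ((real ^ 'd) \<times> real) set"
  assumes "poisson_process M (restrict_space lborel (UNIV \<times> {0..})) \<Psi>"
    and A: "A \<in> sets borel" "A \<subseteq> UNIV \<times> {0..}" "bounded A"
  shows "Measurable.pred M (\<lambda>\<omega>. card (\<Psi> \<omega> \<inter> A) = k)"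
proof -
  interpret poisson_process M "restrict_space lborel (UNIV \<times> {0..})" \<Psi> by fact
  have half_space: "UNIV \<times> {0..} \<in> sets (borel :: ((real ^ 'd) \<times> real) measure)"
    by (intro borel_closed closed_Times) auto
  have "A \<in> sets (restrict_space lborel (UNIV \<times> {0..}))"
    using A half_space by (subst sets_restrict_space_iff) auto
  then have [measurable]: "point_count \<Psi> A \<in> borel_measurable M"
    by (rule measurable_count)
  have count: "card (\<Psi> \<omega> \<inter> A) = k \<longleftrightarrow> point_count \<Psi> A \<omega> = of_nat k" if "\<omega> \<in> space M" for \<omega>
    using locally_finite[OF that A(3)]
    by (simp add: point_count_def emeasure_count_space)
  have "Measurable.pred M (\<lambda>\<omega>. point_count \<Psi> A \<omega> = of_nat k)"
    by measurable
  then show ?thesis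
    using count by (simp cong: measurable_cong)
qed

text \<open>On the event \<open>U\<close> that the \<open>k+1\<close>-st node is well defined, the rational counts decide where it lies;
  off \<open>U\<close> it is the constant \<open>0\<close>. Since \<open>U\<close> is itself measurable (take \<open>B = UNIV\<close>), the two
  pieces fit together to a Borel measurable map on all of \<open>M\<close>.\<close>

lemma nth_node_measurable:
  fixes \<Psi> :: "'w \<Rightarrow> ((real ^ 'd) \<times> real) set" and g :: "real \<Rightarrow> real"
  assumes \<Psi>: "poisson_process M (restrict_space lborel (UNIV \<times> {0..})) \<Psi>"
    and mono: "mono_on {0<..} (window g :: real \<Rightarrow> ((real ^ 'd) \<times> real) set)"
  shows "(\<lambda>\<omega>. nth_node g (\<Psi> \<omega>) (Suc k)) \<in> borel_measurable M"
proof -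
  interpret poisson_process M "restrict_space lborel (UNIV \<times> {0..})" \<Psi> by fact
  define U where "U = (\<lambda>\<omega>. \<exists>!z. is_nth_node g (\<Psi> \<omega>) (Suc k) z)"
  have in_B: "Measurable.pred M (\<lambda>\<omega>. U \<omega> \<and> nth_node g (\<Psi> \<omega>) (Suc k) \<in> B)"
    if B: "B \<in> sets borel" for B
  proof -
    have [measurable]: "Measurable.pred M (\<lambda>\<omega>. card (\<Psi> \<omega> \<inter> arrived_by g q) = m)" for q m
      by (rule poisson_card_measurable[OF \<Psi> borel_arrived_by[OF mono]
            arrived_by_subset_upper_half_space[OF mono] bounded_arrived_by[OF mono]])
    have [measurable]: "Measurable.pred M
        (\<lambda>\<omega>. card (\<Psi> \<omega> \<inter> ((arrived_by g q' - arrived_by g q) \<inter> B)) = m)" for q q' m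
    proof (rule poisson_card_measurable[OF \<Psi>])
      show "(arrived_by g q' - arrived_by g q) \<inter> B \<in> sets borel"
        using borel_arrived_by[OF mono] B by auto
      show "(arrived_by g q' - arrived_by g q) \<inter> B \<subseteq> UNIV \<times> {0..}"
        using arrived_by_subset_upper_half_space[OF mono] by blast
      show "bounded ((arrived_by g q' - arrived_by g q) \<inter> B)"
        by (rule bounded_subset[OF bounded_arrived_by[OF mono, of q']]) auto
    qed
    have "(U \<omega> \<and> nth_node g (\<Psi> \<omega>) (Suc k) \<in> B) \<longleftrightarrow>
      (\<exists>q\<in>\<rat>. \<exists>q'\<in>\<rat>. q < q' \<and> card (\<Psi> \<omega> \<inter> arrived_by g q) = k \<and>
       card (\<Psi> \<omega> \<inter> arrived_by g q') = Suc k \<and>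
       card (\<Psi> \<omega> \<inter> ((arrived_by g q' - arrived_by g q) \<inter> B)) = 1)" if "\<omega> \<in> space M" for \<omega>
      unfolding U_def by (rule nth_node_in_iff_rational_counts[OF mono locally_finite[OF that]])
    moreover have "Measurable.pred M (\<lambda>\<omega>.
      \<exists>q\<in>\<rat>. \<exists>q'\<in>\<rat>. q < q' \<and> card (\<Psi> \<omega> \<inter> arrived_by g q) = k \<and>
       card (\<Psi> \<omega> \<inter> arrived_by g q') = Suc k \<and>
       card (\<Psi> \<omega> \<inter> ((arrived_by g q' - arrived_by g q) \<inter> B)) = 1)"
      using countable_rat by measurable
    ultimately show ?thesis by (subst measurable_cong) auto
  qed
  have unique: "Measurable.pred M U"
    using in_B[of UNIV] by simp
  have default: "nth_node g (\<Psi> \<omega>) (Suc k) = 0" if "\<not> U \<omega>" for \<omega>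
    using that unfolding nth_node_def U_def by (rule if_not_P)
  show ?thesis
  proof (rule borel_measurableI)
    fix B :: "((real ^ 'd) \<times> real) set" assume "open B"
    have default_case: "Measurable.pred M (\<lambda>\<omega>. \<not> U \<omega> \<and> 0 \<in> B)"
      using unique by (cases "0 \<in> B") simp_all
    have by_cases: "Measurable.pred M
        (\<lambda>\<omega>. (U \<omega> \<and> nth_node g (\<Psi> \<omega>) (Suc k) \<in> B) \<or> (\<not> U \<omega> \<and> 0 \<in> B))"
      by (rule pred_intros_logic(5)[OF in_B[OF borel_open[OF \<open>open B\<close>]] default_case])
    have cases_eq: "(\<lambda>\<omega>. (U \<omega> \<and> nth_node g (\<Psi> \<omega>) (Suc k) \<in> B) \<or> (\<not> U \<omega> \<and> 0 \<in> B)) =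
        (\<lambda>\<omega>. nth_node g (\<Psi> \<omega>) (Suc k) \<in> B)"
    proof
      fix \<omega>
      show "(U \<omega> \<and> nth_node g (\<Psi> \<omega>) (Suc k) \<in> B) \<or> (\<not> U \<omega> \<and> 0 \<in> B) \<longleftrightarrow>
          nth_node g (\<Psi> \<omega>) (Suc k) \<in> B"
        using default[of \<omega>] by (cases "U \<omega>") simp_all
    qed
    have "{\<omega> \<in> space M. nth_node g (\<Psi> \<omega>) (Suc k) \<in> B} \<in> sets M"
      using by_cases unfolding cases_eq pred_def .
    also have "{\<omega> \<in> space M. nth_node g (\<Psi> \<omega>) (Suc k) \<in> B} =
        (\<lambda>\<omega>. nth_node g (\<Psi> \<omega>) (Suc k)) -` B \<inter> space M" by blast
    finally show "(\<lambda>\<omega>. nth_node g (\<Psi> \<omega>) (Suc k)) -` B \<inter> space M \<in> sets M" .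
  qed
qed

section \<open>The mixture of edge laws\<close>

text \<open>Finite-dimensional cylinders generate the product \<open>\<sigma>\<close>-algebra and are stable under intersection,
  and the mass of a cylinder is a finite product of masses of the factors, so measurability passes from
  the factors to an arbitrary, even uncountable, product.\<close>

lemma measurable_PiM_kernel:
  assumes \<kappa>: "\<And>i. i \<in> I \<Longrightarrow> \<kappa> i \<in> M \<rightarrow>\<^sub>M prob_algebra (N i)"
  shows "(\<lambda>\<omega>. \<Pi>\<^sub>M i\<in>I. \<kappa> i \<omega>) \<in> M \<rightarrow>\<^sub>M prob_algebra (PiM I N)"
proof (rule measurable_prob_algebra_generated[OF sets_PiM Int_stable_prod_algebra
      prod_algebra_sets_into_space])
  fix \<omega> assume \<omega>: "\<omega> \<in> space M"
  have prob: "prob_space (\<kappa> i \<omega>)" and sets: "sets (\<kappa> i \<omega>) = sets (N i)" if "i \<in> I" for i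
    using measurable_space[OF \<kappa>[OF that] \<omega>] by (auto simp: space_prob_algebra)
  show "prob_space (\<Pi>\<^sub>M i\<in>I. \<kappa> i \<omega>)" by (rule prob_space_PiM[OF prob])
  show "sets (\<Pi>\<^sub>M i\<in>I. \<kappa> i \<omega>) = sets (PiM I N)" by (rule sets_PiM_cong[OF refl sets])
next
  fix A assume "A \<in> prod_algebra I N"
  then obtain J E where A: "A = prod_emb I N J (\<Pi>\<^sub>E j\<in>J. E j)" and J: "finite J" "J \<subseteq> I"
    and E: "\<And>j. j \<in> J \<Longrightarrow> E j \<in> sets (N j)"
    by (rule prod_algebraE) blast
  have "emeasure (\<Pi>\<^sub>M i\<in>I. \<kappa> i \<omega>) A = (\<Prod>j\<in>J. emeasure (\<kappa> j \<omega>) (E j))" if \<omega>: "\<omega> \<in> space M" for \<omega>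
  proof -
    have prob: "prob_space (\<kappa> i \<omega>)" and sets: "sets (\<kappa> i \<omega>) = sets (N i)" if "i \<in> I" for i
      using measurable_space[OF \<kappa>[OF that] \<omega>] by (auto simp: space_prob_algebra)
    have "A = prod_emb I (\<lambda>i. \<kappa> i \<omega>) J (\<Pi>\<^sub>E j\<in>J. E j)"
      unfolding A prod_emb_def using sets_eq_imp_space_eq[OF sets]
      by (auto simp: PiE_iff)
    then show ?thesis
      using emeasure_PiM_emb[of I "\<lambda>i. \<kappa> i \<omega>" J E] prob sets J E by (simp add: subset_iff)
  qed
  moreover have "(\<lambda>\<omega>. \<Prod>j\<in>J. emeasure (\<kappa> j \<omega>) (E j)) \<in> borel_measurable M"
    using J by (intro borel_measurable_prod_ennreal measurable_compose[OF
          measurable_prob_algebraD[OF \<kappa>] measurable_emeasure_subprob_algebra] E) auto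
  ultimately show "(\<lambda>\<omega>. emeasure (\<Pi>\<^sub>M i\<in>I. \<kappa> i \<omega>) A) \<in> borel_measurable M"
    by (subst measurable_cong)
qed

lemma measurable_bernoulli_kernel:
  assumes f: "f \<in> borel_measurable M" and range: "\<And>\<omega>. \<omega> \<in> space M \<Longrightarrow> f \<omega> \<in> {0..1}"
  shows "(\<lambda>\<omega>. measure_pmf (bernoulli_pmf (f \<omega>))) \<in> M \<rightarrow>\<^sub>M prob_algebra (count_space UNIV)"
proof (rule measurable_prob_algebraI)
  show "(\<lambda>\<omega>. measure_pmf (bernoulli_pmf (f \<omega>))) \<in> M \<rightarrow>\<^sub>M subprob_algebra (count_space UNIV)"
  proof (rule measurable_subprob_algebra)
    fix X :: "bool set"
    have "emeasure (measure_pmf (bernoulli_pmf (f \<omega>))) X =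
        ennreal (of_bool (True \<in> X) * f \<omega> + of_bool (False \<in> X) * (1 - f \<omega>))"
      if "\<omega> \<in> space M" for \<omega>
    proof -
      have "emeasure (measure_pmf (bernoulli_pmf (f \<omega>))) X = ennreal (\<Sum>b\<in>X. pmf (bernoulli_pmf (f \<omega>)) b)"
        by (simp add: measure_pmf.emeasure_eq_measure measure_measure_pmf_finite)
      also have "(\<Sum>b\<in>X. pmf (bernoulli_pmf (f \<omega>)) b) =
          (\<Sum>b\<in>UNIV. of_bool (b \<in> X) * pmf (bernoulli_pmf (f \<omega>)) b)"
        by (rule sum.mono_neutral_cong_left) auto
      finally show ?thesis using range[OF that] by (simp add: UNIV_bool add.commute)
    qed
    then show "(\<lambda>\<omega>. emeasure (measure_pmf (bernoulli_pmf (f \<omega>))) X) \<in> borel_measurable M"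
      using f by (subst measurable_cong) auto
  qed (auto intro: prob_space_imp_subprob_space measure_pmf.prob_space_axioms)
qed (rule measure_pmf.prob_space_axioms)

text \<open>Monotonicity is only known on the half line, so \<open>K\<close> is extended to the negative numbers by its
  value at \<open>0\<close>; norms do not see the extension.\<close>

lemma borel_measurable_antimono_norm:
  fixes K :: "real \<Rightarrow> real" and h :: "'w \<Rightarrow> 'a::real_normed_vector"
  assumes "antimono_on {0..} K" and h: "(\<lambda>\<omega>. norm (h \<omega>)) \<in> borel_measurable M"
  shows "(\<lambda>\<omega>. K (norm (h \<omega>))) \<in> borel_measurable M"
proof -
  have "mono (\<lambda>u. - K (max 0 u))"
    using assms(1) by (auto simp: mono_def monotone_on_def)
  then have "(\<lambda>u. - K (max 0 u)) \<in> borel_measurable borel"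
    by (rule borel_measurable_mono)
  from borel_measurable_uminus[OF measurable_compose[OF h this]] show ?thesis by simp
qed

lemma edge_law_measurable:
  fixes \<Psi> :: "'w \<Rightarrow> ((real ^ 'd) \<times> real) set" and g K :: "real \<Rightarrow> real"
  assumes \<Psi>: "poisson_process M (restrict_space lborel (UNIV \<times> {0..})) \<Psi>"
    and mono: "mono_on {0<..} (window g :: real \<Rightarrow> ((real ^ 'd) \<times> real) set)"
    and K: "\<And>u. 0 \<le> u \<Longrightarrow> K u \<in> {0..1}" "antimono_on {0..} K"
  shows "(\<lambda>\<omega>. edge_law g K (\<Psi> \<omega>)) \<in> M \<rightarrow>\<^sub>M prob_algebra (\<Pi>\<^sub>M _\<in>node_pairs. count_space UNIV)"
  unfolding edge_law_def
proof (rule measurable_PiM_kernel)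
  fix ij assume "ij \<in> node_pairs"
  \<comment> \<open>Node numbers start at \<open>1\<close>.\<close>
  then obtain a b where ab: "ij = (a, b)" "0 < a" "0 < b"
    unfolding node_pairs_def by auto
  obtain i where "a = Suc i" using gr0_implies_Suc[OF ab(2)] ..
  moreover obtain j where "b = Suc j" using gr0_implies_Suc[OF ab(3)] ..
  ultimately have ij: "ij = (Suc i, Suc j)" using ab(1) by simp
  have position: "(\<lambda>\<omega>. latent_position g (\<Psi> \<omega>) (Suc k)) \<in> borel_measurable M" for k
    unfolding latent_position_def
    by (rule measurable_compose[OF nth_node_measurable[OF \<Psi> mono]
          borel_measurable_continuous_onI[OF continuous_on_fst[OF continuous_on_id]]])
  have link: "(\<lambda>\<omega>. K (norm (latent_position g (\<Psi> \<omega>) (Suc i) - latent_position g (\<Psi> \<omega>) (Suc j))))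
      \<in> borel_measurable M"
    by (rule borel_measurable_antimono_norm[OF K(2)
          measurable_compose[OF borel_measurable_diff[OF position position] borel_measurable_norm]])
  show "(\<lambda>\<omega>. case ij of (i, j) \<Rightarrow> measure_pmf (bernoulli_pmf
      (K (norm (latent_position g (\<Psi> \<omega>) i - latent_position g (\<Psi> \<omega>) j)))))
      \<in> M \<rightarrow>\<^sub>M prob_algebra (count_space UNIV)"
    unfolding ij prod.case by (rule measurable_bernoulli_kernel[OF link K(1)[OF norm_ge_zero]])
qed

lemma
  fixes \<Psi> :: "'w \<Rightarrow> ((real ^ 'd) \<times> real) set" and g K :: "real \<Rightarrow> real"
  assumes \<Psi>: "poisson_process M (restrict_space lborel (UNIV \<times> {0..})) \<Psi>"
    and mono: "mono_on {0<..} (window g :: real \<Rightarrow> ((real ^ 'd) \<times> real) set)"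
    and K: "\<And>u. 0 \<le> u \<Longrightarrow> K u \<in> {0..1}" "antimono_on {0..} K"
  shows prob_space_graph_law: "prob_space (graph_law g K M \<Psi>)"
    and sets_graph_law: "sets (graph_law g K M \<Psi>) = sets (\<Pi>\<^sub>M _\<in>node_pairs. count_space UNIV)"
proof -
  interpret poisson_process M "restrict_space lborel (UNIV \<times> {0..})" \<Psi> by fact
  have M: "M \<in> space (prob_algebra M)"
    by (simp add: space_prob_algebra prob_space_axioms)
  show "prob_space (graph_law g K M \<Psi>)"
    unfolding graph_law_def by (rule prob_space_bind'[OF M edge_law_measurable[OF assms]])
  show "sets (graph_law g K M \<Psi>) = sets (\<Pi>\<^sub>M _\<in>node_pairs. count_space UNIV)"
    unfolding graph_law_def by (rule sets_bind'[OF M edge_law_measurable[OF assms]])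
qed

section \<open>Nested adjacency matrices\<close>

lemma adjacency_matrix_in_binary_matrices: "adjacency_matrix n e \<in> binary_matrices n"
  unfolding adjacency_matrix_def binary_matrices_def by auto

lemma finite_binary_matrices: "finite (binary_matrices n)"
  unfolding binary_matrices_def by (intro finite_PiE) auto

lemma adjacency_matrix_eq_iff:
  assumes y: "y \<in> binary_matrices n"
  shows "adjacency_matrix n e = y \<longleftrightarrow>
    (\<forall>i\<in>{1..n}. \<forall>j\<in>{1..n}. adjacency_matrix n e (i, j) = y (i, j))"
proof
  assume entries: "\<forall>i\<in>{1..n}. \<forall>j\<in>{1..n}. adjacency_matrix n e (i, j) = y (i, j)"
  show "adjacency_matrix n e = y"
  proof (rule PiE_ext)
    show "adjacency_matrix n e \<in> {1..n} \<times> {1..n} \<rightarrow>\<^sub>E {0, 1}"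
      using adjacency_matrix_in_binary_matrices unfolding binary_matrices_def .
    show "y \<in> {1..n} \<times> {1..n} \<rightarrow>\<^sub>E {0, 1}"
      using y unfolding binary_matrices_def .
  qed (use entries in auto)
qed auto

lemma adjacency_matrix_measurable:
  "adjacency_matrix n \<in> (\<Pi>\<^sub>M _\<in>node_pairs. count_space UNIV) \<rightarrow>\<^sub>M count_space (binary_matrices n)"
  (is "_ \<in> ?E \<rightarrow>\<^sub>M _")
proof (subst measurable_count_space_eq2[OF finite_binary_matrices], intro conjI ballI)
  show "adjacency_matrix n \<in> space ?E \<rightarrow> binary_matrices n"
    using adjacency_matrix_in_binary_matrices by blast
next
  fix y assume y: "y \<in> binary_matrices n"
  have edge [measurable]: "Measurable.pred ?E (\<lambda>e. e (i, j))" if "1 \<le> i" "i < j" for i j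
    by (rule measurable_component_singleton) (use that in \<open>simp add: node_pairs_def\<close>)
  have entry: "Measurable.pred ?E (\<lambda>e. adjacency_matrix n e (i, j) = y (i, j))"
    if "i \<in> {1..n}" "j \<in> {1..n}" for i j
  proof -
    consider "i < j" | "j < i" | "i = j" by linarith
    then show ?thesis
    proof cases
      case 1
      then have [measurable]: "Measurable.pred ?E (\<lambda>e. e (i, j))" using edge that by simp
      show ?thesis using 1 that by (simp add: adjacency_matrix_def)
    next
      case 2
      then have [measurable]: "Measurable.pred ?E (\<lambda>e. e (j, i))" using edge that by simp
      show ?thesis using 2 that by (simp add: adjacency_matrix_def)
    qed (use that in \<open>simp add: adjacency_matrix_def\<close>)
  qed
  have "adjacency_matrix n -` {y} \<inter> space ?E = {e \<in> space ?E.
      \<forall>i\<in>{1..n}. \<forall>j\<in>{1..n}. adjacency_matrix n e (i, j) = y (i, j)}"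
    using adjacency_matrix_eq_iff[OF y] by blast
  moreover have "Measurable.pred ?E
      (\<lambda>e. \<forall>i\<in>{1..n}. \<forall>j\<in>{1..n}. adjacency_matrix n e (i, j) = y (i, j))"
    by (intro pred_intros_finite entry) auto
  ultimately show "adjacency_matrix n -` {y} \<inter> space ?E \<in> sets ?E"
    by (simp add: pred_def)
qed

text \<open>The entry \<open>(i, j)\<close> of an adjacency matrix does not depend on the size of the matrix.\<close>

lemma adjacency_matrix_eq_iff_extends:
  assumes "n1 \<le> n2" and y: "y \<in> binary_matrices n1"
  shows "adjacency_matrix n1 e = y \<longleftrightarrow>
    (\<forall>i\<in>{1..n1}. \<forall>j\<in>{1..n1}. adjacency_matrix n2 e (i, j) = y (i, j))"
proof -
  have "adjacency_matrix n1 e (i, j) = adjacency_matrix n2 e (i, j)"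
    if "i \<in> {1..n1}" "j \<in> {1..n1}" for i j
    using that \<open>n1 \<le> n2\<close> by (simp add: adjacency_matrix_def)
  then show ?thesis unfolding adjacency_matrix_eq_iff[OF y] by simp
qed

text \<open>Any law on infinite graphs gives a projective sequence: both sides of the projectivity
  equation are the probability of one set of infinite graphs, those whose first \<open>n1\<close> nodes span \<open>y\<close>.\<close>

lemma projective_adjacency_matrix_laws:
  assumes "prob_space G" and sets: "sets G = sets (\<Pi>\<^sub>M _\<in>node_pairs. count_space UNIV)"
  shows "projective (\<lambda>n. distr G (count_space (binary_matrices n)) (adjacency_matrix n))"
proof -
  interpret prob_space G by fact
  have meas: "adjacency_matrix n \<in> G \<rightarrow>\<^sub>M count_space (binary_matrices n)" for n
    using adjacency_matrix_measurable[of n] by (simp add: measurable_cong_sets[OF sets refl])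
  show ?thesis
    unfolding projective_def
  proof (intro conjI allI impI ballI)
    fix n show "prob_space (distr G (count_space (binary_matrices n)) (adjacency_matrix n))"
      by (rule prob_space_distr[OF meas])
  next
    fix n1 n2 :: nat and y assume "n1 < n2" and y: "y \<in> binary_matrices n1"
    let ?X = "{x \<in> binary_matrices n2. \<forall>i\<in>{1..n1}. \<forall>j\<in>{1..n1}. x (i, j) = y (i, j)}"
    have "adjacency_matrix n1 -` {y} = adjacency_matrix n2 -` ?X"
      using adjacency_matrix_eq_iff_extends[OF less_imp_le[OF \<open>n1 < n2\<close>] y]
        adjacency_matrix_in_binary_matrices by auto
    then show "measure (distr G (count_space (binary_matrices n1)) (adjacency_matrix n1)) {y} =
        measure (distr G (count_space (binary_matrices n2)) (adjacency_matrix n2)) ?X"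
      using y by (simp add: measure_distr[OF meas])
  qed simp
qed

section \<open>Projectivity of the rectangular model\<close>

theorem theorem1:
  fixes p :: real and K :: "real \<Rightarrow> real"
    and M :: "'w measure" and \<Psi> :: "'w \<Rightarrow> ((real ^ 'd) \<times> real) set"
  assumes "0 \<le> p" and "p \<le> 1"
    and "\<And>u. 0 \<le> u \<Longrightarrow> K u \<in> {0..1}"
    and "antimono_on {0..} K"
    and "0 < (\<integral>\<^sup>+ u \<in> {0..}. ennreal (u ^ (CARD('d) - 1) * K u) \<partial>lborel)"
    and "(\<integral>\<^sup>+ u \<in> {0..}. ennreal (u ^ (CARD('d) - 1) * K u) \<partial>lborel) < \<infinity>"
    and "poisson_process M (restrict_space lborel (UNIV \<times> {0..})) \<Psi>"
  shows "projective (rectangular_LPM p K M \<Psi>)"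
  unfolding rectangular_LPM_def[abs_def]
  by (intro projective_adjacency_matrix_laws
      prob_space_graph_law[OF assms(7) window_powr_mono[OF assms(1,2)] assms(3,4)]
      sets_graph_law[OF assms(7) window_powr_mono[OF assms(1,2)] assms(3,4)])

end
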